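(* Let $[\theta^\top, y_1^\top,\dots,y_N^\top]^\top \in \mathbb{R}^{n_\theta+pN}$ be a point that satisfies the first-order optimality conditions of the constrained problem (C) defined in the context. Then the point $[\theta^\top,y_1^\top,\dots,y_n^\top]^\top \in \mathbb{R}^{n_\theta+pn}$ is a stationary point of the unconstrained problem (U) defined in the context, i.e. the gradient of the objective of (U) with respect to $\zeta$ vanishes at this point.
   Context: Setting. Let $n,p,q,n_\theta,N$ be positive integers with $N>n$. Let $\mathcal{M}:(\mathbb{R}^p)^n\times(\mathbb{R}^q)^{n+1}\times\mathbb{R}^{n_\theta}\to\mathbb{R}^p$ be a differentiable parametric model, $u_1,\dots,u_N\in\mathbb{R}^q$ given inputs, $\tilde y_1,\dots,\tilde y_N\in\mathbb{R}^p$ given output measurements, $W\in\mathbb{R}^{p\times p}$ a positive definite matrix, $\|\eta\|_W=\sqrt{\eta^\top W\eta}$, and $\rho:\mathbb{R}^{n_\theta}\to\mathbb{R}$ a differentiable regularization term. Unconstrained problem (U): minimize over $\zeta=[\theta^\top,y_1^\top,\dots,y_n^\top]^\top\in\mathbb{R}^{n_\theta+pn}$ the objective $$\sum_{t=1}^N\|y_t(\zeta)-\tilde y_t\|_W^2+\rho(\theta),$$ where $y_t(\zeta)=y_t$ for $t=1,\dots,n$ (these are components of $\zeta$) and, recursively for $t=n+1,\dots,N$, $$y_t(\zeta)=\mathcal{M}(y_{t-1}(\zeta),\dots,y_{t-n}(\zeta),u_t,\dots,u_{t-n},\theta).$$ Constrained problem (C): minimize over $\xi=[\theta^\top,y_1^\top,\dots,y_N^\top]^\top\in\mathbb{R}^{n_\theta+pN}$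 the cost $$\mathcal{L}(\xi)=\sum_{t=1}^N\|\tilde y_t-y_t\|_W^2+\rho(\theta)$$ subject to $y_t=\mathcal{M}(y_{t-1},\dots,y_{t-n},u_t,\dots,u_{t-n},\theta)$ for $t=n+1,\dots,N$. Write $m=p(N-n)$ and let $h:\mathbb{R}^{n_\theta+pN}\to\mathbb{R}^m$ be the stacked constraint function whose blocks are $$h_t(\xi)=y_{t+n}-\mathcal{M}(y_{t+n-1},\dots,y_t,u_{t+n},\dots,u_t,\theta)\in\mathbb{R}^p,\qquad t=1,\dots,N-n,$$ with Jacobian $J_h(\xi)\in\mathbb{R}^{m\times(n_\theta+pN)}$. A point $\xi$ satisfies the first-order optimality conditions of (C) if there exists $\lambda\in\mathbb{R}^m$ such that $$\nabla_\xi\mathcal{L}(\xi)+J_h(\xi)^\top\lambda=0\quad\text{and}\quad h(\xi)=0.$$ *)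

theory Defs
  imports "HOL-Analysis.Analysis"
begin

text \<open>
  The integers \<open>n\<close>, \<open>N\<close>, \<open>N - n\<close>, \<open>p\<close>, \<open>q\<close>, \<open>n\<^sub>\<theta>\<close> are the cardinalities of finite index types
  \<open>'n\<close>, \<open>'N\<close>, \<open>'m\<close>, \<open>'p\<close>, \<open>'q\<close>, \<open>'th\<close>. Types that index positions in time carry a linear order, so
  that their elements are numbered \<open>1, ..., CARD('t)\<close>.
\<close>

definition pos :: "'t::{finite,linorder} \<Rightarrow> nat" where
  "pos i = card {..i}"

definition idx :: "nat \<Rightarrow> 't::{finite,linorder}" where
  "idx t = (THE i. pos i = t)"

lemma pos_ge_1: "1 \<le> pos i"
  by (simp add: pos_def Suc_le_eq card_gt_0_iff)

lemma pos_le_CARD: "pos (i::'t::{finite,linorder}) \<le> CARD('t)"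
  unfolding pos_def by (intro card_mono) auto

lemma strict_mono_pos: "strict_mono pos"
  unfolding strict_mono_def pos_def by (intro allI impI psubset_card_mono) auto

lemma inj_pos: "inj pos"
  by (rule strict_mono_imp_inj_on[OF strict_mono_pos])

lemma range_pos: "range (pos :: 't::{finite,linorder} \<Rightarrow> nat) = {1..CARD('t)}"
proof (rule card_subset_eq)
  show "range (pos :: 't \<Rightarrow> nat) \<subseteq> {1..CARD('t)}"
    using pos_ge_1 pos_le_CARD by fastforce
qed (simp_all add: card_image inj_pos)

lemma idx_pos [simp]: "idx (pos i) = i"
  unfolding idx_def by (rule the_equality) (auto dest: injD[OF inj_pos])

lemma pos_idx: "t \<in> {1..CARD('t)} \<Longrightarrow> pos (idx t :: 't::{finite,linorder}) = t"
  using range_pos[where 't = 't] by (metis idx_pos imageE)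

text \<open>
  The vector \<open>[\<theta>, y\<^sub>1, ..., y\<^sub>T]\<close> of dimension \<open>n\<^sub>\<theta> + p T\<close>, where \<open>T = CARD('t)\<close>, together with its
  blocks. Only the values of \<open>y\<close> on \<open>{1..T}\<close> matter, and \<open>outp x t\<close> is meaningful only for such \<open>t\<close>.
\<close>

definition stack ::
    "real^'th::finite \<Rightarrow> (nat \<Rightarrow> real^'p::finite) \<Rightarrow> real^('th::finite + 't::{finite,linorder} \<times> 'p::finite)" where
  "stack \<theta> y = (\<chi> c. case c of Inl k \<Rightarrow> \<theta> $ k | Inr (i, j) \<Rightarrow> y (pos i) $ j)"

definition param :: "real^('th::finite + 't::{finite,linorder} \<times> 'p::finite) \<Rightarrow> real^'th" where
  "param x = (\<chi> k. x $ Inl k)"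

definition outp :: "real^('th::finite + 't::{finite,linorder} \<times> 'p::finite) \<Rightarrow> nat \<Rightarrow> real^'p" where
  "outp x t = (\<chi> j. x $ Inr (idx t, j))"

definition pos_definite :: "real^'p^'p \<Rightarrow> bool" where
  "pos_definite W \<longleftrightarrow> (\<forall>x. x \<noteq> 0 \<longrightarrow> 0 < x \<bullet> (W *v x))"

definition wnorm :: "real^'p^'p \<Rightarrow> real^'p \<Rightarrow> real" where
  "wnorm W x = sqrt (x \<bullet> (W *v x))"

text \<open>
  A model takes \<open>(y\<^sub>t\<^sub>-\<^sub>1, ..., y\<^sub>t\<^sub>-\<^sub>n)\<close>, indexed by \<open>'n\<close>, the \<open>n + 1\<close> inputs \<open>(u\<^sub>t, ..., u\<^sub>t\<^sub>-\<^sub>n)\<close>,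
  indexed by \<open>'n option\<close> with \<open>None\<close> for the current one, and \<open>\<theta>\<close>.
\<close>

type_synonym ('n, 'p, 'q, 'th) model =
  "((real^'p)^'n) \<times> ((real^'q)^('n option)) \<times> (real^'th) \<Rightarrow> real^'p"

fun lag :: "'n::{finite,linorder} option \<Rightarrow> nat" where
  "lag None = 0"
| "lag (Some i) = pos i"

function simulate ::
    "('n::{finite,linorder}, 'p::finite, 'q::finite, 'th::finite) model \<Rightarrow> (nat \<Rightarrow> real^'q)
      \<Rightarrow> real^('th + 'n \<times> 'p) \<Rightarrow> nat \<Rightarrow> real^'p" where
  "simulate M u \<zeta> t =
     (if t \<le> CARD('n) then outp \<zeta> t
      else M (\<chi> i. simulate M u \<zeta> (t - pos i), \<chi> l. u (t - lag l), param \<zeta>))"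
  by auto
termination
proof (relation "Wellfounded.measure (\<lambda>(M, u, \<zeta>, t). t)")
  fix M :: "('n::{finite,linorder}, 'p::finite, 'q::finite, 'th::finite) model"
    and u :: "nat \<Rightarrow> real^'q" and \<zeta> :: "real^('th + 'n \<times> 'p)" and t and i :: 'n
  assume "\<not> t \<le> CARD('n)"
  then show "((M, u, \<zeta>, t - pos i), (M, u, \<zeta>, t)) \<in> Wellfounded.measure (\<lambda>(M, u, \<zeta>, t). t)"
    using pos_ge_1[of i] by simp
qed simp

declare simulate.simps [simp del]

definition objective_U ::
    "('n::{finite,linorder}, 'p::finite, 'q::finite, 'th::finite) model \<Rightarrow> (nat \<Rightarrow> real^'q)
      \<Rightarrow> (nat \<Rightarrow> real^'p) \<Rightarrow> real^'p^'p \<Rightarrow> (real^'th \<Rightarrow> real) \<Rightarrow> nat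
      \<Rightarrow> real^('th + 'n \<times> 'p) \<Rightarrow> real" where
  "objective_U M u ymeas W \<rho> N \<zeta> =
     (\<Sum>t=1..N. (wnorm W (simulate M u \<zeta> t - ymeas t))\<^sup>2) + \<rho> (param \<zeta>)"

definition cost_C ::
    "(nat \<Rightarrow> real^'p) \<Rightarrow> real^'p^'p \<Rightarrow> (real^'th \<Rightarrow> real)
      \<Rightarrow> real^('th::finite + 'N::{finite,linorder} \<times> 'p::finite) \<Rightarrow> real" where
  "cost_C ymeas W \<rho> \<xi> =
     (\<Sum>t=1..CARD('N). (wnorm W (ymeas t - outp \<xi> t))\<^sup>2) + \<rho> (param \<xi>)"

definition constraint_block ::
    "('n::{finite,linorder}, 'p::finite, 'q::finite, 'th::finite) model \<Rightarrow> (nat \<Rightarrow> real^'q)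
      \<Rightarrow> real^('th + 'N::{finite,linorder} \<times> 'p) \<Rightarrow> nat \<Rightarrow> real^'p" where
  "constraint_block M u \<xi> t =
     (let s = t + CARD('n)
      in outp \<xi> s - M (\<chi> i. outp \<xi> (s - pos i), \<chi> l. u (s - lag l), param \<xi>))"

text \<open>The blocks are stacked over \<open>'m\<close>, which must have \<open>CARD('N) - CARD('n)\<close> elements.\<close>

definition constraint ::
    "('n::{finite,linorder}, 'p::finite, 'q::finite, 'th::finite) model \<Rightarrow> (nat \<Rightarrow> real^'q)
      \<Rightarrow> real^('th + 'N::{finite,linorder} \<times> 'p) \<Rightarrow> real^('m::{finite,linorder} \<times> 'p)" where
  "constraint M u \<xi> = (\<chi> c. case c of (k, j) \<Rightarrow> constraint_block M u \<xi> (pos k) $ j)"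

definition first_order_optimal ::
    "(real^'a \<Rightarrow> real) \<Rightarrow> (real^'a \<Rightarrow> real^'b) \<Rightarrow> real^'a \<Rightarrow> bool" where
  "first_order_optimal L h \<xi> \<longleftrightarrow>
     (\<exists>g \<mu>. GDERIV L \<xi> :> g \<and> g + transpose (jacobian h (at \<xi>)) *v \<mu> = 0) \<and> h \<xi> = 0"

definition stationary_point :: "(real^'a \<Rightarrow> real) \<Rightarrow> real^'a \<Rightarrow> bool" where
  "stationary_point f x \<longleftrightarrow> GDERIV f x :> 0"

end

theory Submission
  imports Defs
begin

text \<open>
  Let \<open>E\<close> send \<open>\<zeta>\<close> to the full trajectory \<open>[\<theta>, y\<^sub>1(\<zeta>), ..., y\<^sub>N(\<zeta>)]\<close>. It parametrises the feasible set
  of (C): it is differentiable, \<open>h \<circ> E = 0\<close>, every feasible point is the image of its first blocks,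
  and the objective of (U) is \<open>\<L> \<circ> E\<close>. By the chain rule the derivative of the latter at \<open>\<zeta>\<close> in
  direction \<open>v\<close> is \<open>\<nabla>\<L> \<bullet> E'v = - \<lambda> \<bullet> (J\<^sub>h E'v)\<close>, and \<open>J\<^sub>h E' = 0\<close> by differentiating \<open>h \<circ> E = 0\<close>.
\<close>

section \<open>Differentiability of componentwise and paired maps\<close>

lemma differentiable_vec_lambda:
  fixes f :: "'i::finite \<Rightarrow> 'a::real_normed_vector \<Rightarrow> 'b::real_normed_vector"
  assumes "\<And>i. f i differentiable F"
  shows "(\<lambda>x. \<chi> i. f i x) differentiable F"
proof -
  have lin: "bounded_linear (axis i :: 'b \<Rightarrow> 'b^'i)" for i
  proof (rule bounded_linear_intro[where K = 1])
    \<comment> \<open>Only one coordinate is nonzero, so the Euclidean norm collapses to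
      \<open>norm x\<close>.\<close>
    show "norm (axis i x :: 'b^'i) \<le> norm x * 1" for x :: 'b
      by (simp add: norm_vec_def L2_set_def axis_def if_distrib[of norm] if_distrib[of "\<lambda>r. r\<^sup>2"]
          cong: if_cong)
  qed (simp_all add: axis_def vec_eq_iff)
  \<comment> \<open>A vector is the finite sum of its entries embedded by the bounded linear maps
    \<open>axis i\<close>. The entries may lie in any normed space because the past outputs fed to
    the model form a vector of vectors.\<close>
  have "(\<lambda>x. \<Sum>i\<in>UNIV. axis i (f i x)) differentiable F"
  proof (intro differentiable_sum ballI)
    fix i
    from assms obtain D where "(f i has_derivative D) F"
      unfolding differentiable_def by blast
    then show "(\<lambda>x. axis i (f i x) :: 'b^'i) differentiable F"
      unfolding differentiable_def using bounded_linear.has_derivative[OF lin] by blast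
  qed simp
  moreover have "(\<Sum>i\<in>UNIV. axis i (f i x)) = (\<chi> i. f i x)" for x
    by (simp add: vec_eq_iff axis_def sum.delta)
  ultimately show ?thesis by simp
qed

lemma differentiable_vec_nth:
  fixes f :: "'a::real_normed_vector \<Rightarrow> 'b::real_normed_vector^'i"
  assumes "f differentiable F"
  shows "(\<lambda>x. f x $ i) differentiable F"
  using assms bounded_linear.has_derivative[OF bounded_linear_vec_nth]
  unfolding differentiable_def by blast

lemma differentiable_Pair:
  assumes "f differentiable (at x within S)" "g differentiable (at x within S)"
  shows "(\<lambda>x. (f x, g x)) differentiable (at x within S)"
  using assms has_derivative_Pair unfolding differentiable_def by blast

section \<open>Stacked vectors and their blocks\<close>

lemma param_stack [simp]: "param (stack \<theta> y) = \<theta>"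
  by (simp add: param_def stack_def vec_eq_iff)

lemma outp_stack:
  assumes "t \<in> {1..CARD('t)}"
  shows "outp (stack \<theta> y :: real^('th::finite + 't::{finite,linorder} \<times> 'p::finite)) t = y t"
  by (simp add: outp_def stack_def vec_eq_iff pos_idx[OF assms])

lemma stack_param_outp [simp]: "stack (param x) (outp x) = x"
  by (auto simp: vec_eq_iff stack_def param_def outp_def split: sum.split)

text \<open>Allows stacks to be compared although \<open>outp\<close> says nothing useful at times
  outside the range of \<open>pos\<close>.\<close>

lemma stack_cong:
  assumes "\<And>t. t \<in> {1..CARD('t)} \<Longrightarrow> y t = z t"
  shows "(stack \<theta> y :: real^('th::finite + 't::{finite,linorder} \<times> 'p::finite)) = stack \<theta> z"
proof -
  have "y (pos i) = z (pos i)" for i :: 't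
    using assms[of "pos i"] pos_ge_1[of i] pos_le_CARD[of i] by simp
  then show ?thesis by (auto simp: stack_def vec_eq_iff split: sum.split)
qed

lemma param_differentiable: "param differentiable F"
  unfolding param_def[abs_def]
  by (intro differentiable_vec_lambda bounded_linear_imp_differentiable bounded_linear_vec_nth)

lemma outp_differentiable: "(\<lambda>x. outp x t) differentiable F"
  unfolding outp_def[abs_def]
  by (intro differentiable_vec_lambda bounded_linear_imp_differentiable bounded_linear_vec_nth)

lemma stack_differentiable:
  fixes f :: "'a::real_normed_vector \<Rightarrow> real^'th::finite"
  assumes "f differentiable F" and "\<And>t. (\<lambda>x. g x t) differentiable F"
  shows "(\<lambda>x. stack (f x) (g x) :: real^('th + 't::{finite,linorder} \<times> 'p::finite)) differentiable F"
  unfolding stack_def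
proof (rule differentiable_vec_lambda)
  fix c :: "'th + 't \<times> 'p"
  show "(\<lambda>x. case c of Inl k \<Rightarrow> f x $ k | Inr (i, j) \<Rightarrow> g x (pos i) $ j) differentiable F"
    by (cases c) (auto simp: split_beta intro: differentiable_vec_nth assms)
qed

section \<open>Differentiability of the simulation and of the constraints\<close>

lemma model_step_differentiable:
  fixes M :: "('n::finite, 'p::finite, 'q::finite, 'th::finite) model"
  assumes "\<forall>x. M differentiable (at x)"
    and "\<And>i. (\<lambda>x. f x i) differentiable (at x)" and "g differentiable (at x)"
  shows "(\<lambda>x. M (\<chi> i. f x i, w, g x)) differentiable (at x)"
proof -
  have "(\<lambda>x. (\<chi> i. f x i, w, g x)) differentiable (at x)"
    by (intro differentiable_Pair differentiable_vec_lambda assms(2,3) differentiable_const)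
  from differentiable_chain_at[OF this, of M] assms(1) show ?thesis
    by (simp only: o_def)
qed

lemma simulate_differentiable:
  fixes M :: "('n::{finite,linorder}, 'p::finite, 'q::finite, 'th::finite) model"
  assumes M: "\<forall>x. M differentiable (at x)"
  shows "(\<lambda>\<zeta>. simulate M u \<zeta> t) differentiable (at \<zeta>)"
proof (induction t rule: less_induct)
  case (less t)
  show ?case
  proof (cases "t \<le> CARD('n)")
    case True
    then show ?thesis by (simp add: simulate.simps outp_differentiable)
  next
    case False
    \<comment> \<open>Every lag is at least 1 and \<open>t\<close> is positive here, so even
      truncated subtraction gives a strictly earlier time.\<close>
    then have "(\<lambda>\<zeta>. simulate M u \<zeta> (t - pos i)) differentiable (at \<zeta>)" for i :: 'n
      using pos_ge_1[of i] by (intro less.IH) simp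
    from model_step_differentiable[OF M this param_differentiable] False
    show ?thesis by (simp add: simulate.simps[of _ _ _ t])
  qed
qed

lemma constraint_differentiable:
  fixes M :: "('n::{finite,linorder}, 'p::finite, 'q::finite, 'th::finite) model"
  assumes M: "\<forall>x. M differentiable (at x)"
  shows "(constraint M u :: real^('th + 'N::{finite,linorder} \<times> 'p) \<Rightarrow> real^('m::{finite,linorder} \<times> 'p))
    differentiable (at \<xi>)"
  unfolding constraint_def[abs_def] constraint_block_def Let_def
  by (rule differentiable_vec_lambda)
    (auto intro!: differentiable_vec_nth differentiable_diff outp_differentiable
      model_step_differentiable[OF M] param_differentiable)

section \<open>The feasible set and its parametrisation by initial data\<close>

lemma constraint_eq_0_iff:
  fixes M :: "('n::{finite,linorder}, 'p::finite, 'q::finite, 'th::finite) model"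
    and \<xi> :: "real^('th + 'N::{finite,linorder} \<times> 'p)"
  assumes m: "CARD('m::{finite,linorder}) = CARD('N) - CARD('n)"
  shows "(constraint M u \<xi> :: real^('m \<times> 'p)) = 0 \<longleftrightarrow>
    (\<forall>t\<in>{CARD('n)<..CARD('N)}.
      outp \<xi> t = M (\<chi> i. outp \<xi> (t - pos i), \<chi> l. u (t - lag l), param \<xi>))"
    (is "_ \<longleftrightarrow> (\<forall>t\<in>_. ?feas t)")
proof -
  have "(constraint M u \<xi> :: real^('m \<times> 'p)) = 0 \<longleftrightarrow> (\<forall>k::'m. constraint_block M u \<xi> (pos k) = 0)"
    by (auto simp: constraint_def vec_eq_iff)
  also have "\<dots> \<longleftrightarrow> (\<forall>s\<in>range (pos :: 'm \<Rightarrow> nat). constraint_block M u \<xi> s = 0)"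
    by blast
  also have "\<dots> \<longleftrightarrow> (\<forall>s\<in>{1..CARD('N) - CARD('n)}. ?feas (s + CARD('n)))"
    by (simp add: range_pos m constraint_block_def Let_def)
  also have "\<dots> \<longleftrightarrow> (\<forall>t\<in>(\<lambda>s. s + CARD('n)) ` {1..CARD('N) - CARD('n)}. ?feas t)"
    by blast
  also have "(\<lambda>s. s + CARD('n)) ` {1..CARD('N) - CARD('n)} = {CARD('n)<..CARD('N)}"
    \<comment> \<open>Block \<open>s\<close> constrains the output at time
      \<open>s + CARD('n)\<close>, so the preimage of a time is found by subtracting
      \<open>CARD('n)\<close>.\<close>
    by (auto simp: image_iff intro!: bexI[where x = "_ - CARD('n)"])
  finally show ?thesis .
qed

text \<open>The map \<open>E\<close> of the idea above. The horizon enters only through the index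
  type \<open>'N\<close> of the result, hence the type annotations wherever it is used.\<close>

definition trajectory ::
    "('n::{finite,linorder}, 'p::finite, 'q::finite, 'th::finite) model \<Rightarrow> (nat \<Rightarrow> real^'q)
      \<Rightarrow> real^('th + 'n \<times> 'p) \<Rightarrow> real^('th + 'N::{finite,linorder} \<times> 'p)" where
  "trajectory M u \<zeta> = stack (param \<zeta>) (simulate M u \<zeta>)"

lemma constraint_trajectory:
  fixes M :: "('n::{finite,linorder}, 'p::finite, 'q::finite, 'th::finite) model"
  assumes m: "CARD('m::{finite,linorder}) = CARD('N) - CARD('n)"
  shows "(constraint M u (trajectory M u \<zeta> :: real^('th + 'N::{finite,linorder} \<times> 'p))
    :: real^('m \<times> 'p)) = 0"
  unfolding constraint_eq_0_iff[OF m]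
proof
  fix t assume t: "t \<in> {CARD('n)<..CARD('N)}"
  let ?E = "trajectory M u \<zeta> :: real^('th + 'N \<times> 'p)"
  \<comment> \<open>Since \<open>pos i\<close> is at most \<open>CARD('n)\<close>, which is less
    than \<open>t\<close>, the delayed time is at least 1 and names a genuine block.\<close>
  have "outp ?E (t - pos i) = simulate M u \<zeta> (t - pos i)" for i :: 'n
    using t pos_le_CARD[of i] unfolding trajectory_def by (intro outp_stack) auto
  moreover have "outp ?E t = simulate M u \<zeta> t"
    using t unfolding trajectory_def by (intro outp_stack) auto
  ultimately show "outp ?E t = M (\<chi> i. outp ?E (t - pos i), \<chi> l. u (t - lag l), param ?E)"
    using t by (simp add: simulate.simps[of _ _ _ t] trajectory_def)
qed

text \<open>The constraints are the recursion of \<open>simulate\<close>, so by strong induction on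
  time the first \<open>CARD('n)\<close> outputs and the parameter determine all later
  outputs.\<close>

lemma trajectory_of_feasible:
  fixes M :: "('n::{finite,linorder}, 'p::finite, 'q::finite, 'th::finite) model"
    and \<xi> :: "real^('th + 'N::{finite,linorder} \<times> 'p)"
  assumes m: "CARD('m::{finite,linorder}) = CARD('N) - CARD('n)"
    and feas: "(constraint M u \<xi> :: real^('m \<times> 'p)) = 0"
  shows "trajectory M u (stack (param \<xi>) (outp \<xi>) :: real^('th + 'n \<times> 'p)) = \<xi>"
proof -
  let ?\<zeta> = "stack (param \<xi>) (outp \<xi>) :: real^('th + 'n \<times> 'p)"
  have "simulate M u ?\<zeta> t = outp \<xi> t" if "t \<in> {1..CARD('N)}" for t
    using that
  proof (induction t rule: less_induct)
    case (less t)
    show ?case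
    proof (cases "t \<le> CARD('n)")
      case True
      \<comment> \<open>The premise excludes \<open>t = 0\<close>, which \<open>simulate\<close>
        treats as initial data but which is not a block.\<close>
      with less.prems show ?thesis by (simp add: simulate.simps outp_stack)
    next
      case False
      have "simulate M u ?\<zeta> (t - pos i) = outp \<xi> (t - pos i)" for i :: 'n
        using False less.prems pos_ge_1[of i] pos_le_CARD[of i] by (intro less.IH) auto
      moreover have "outp \<xi> t = M (\<chi> i. outp \<xi> (t - pos i), \<chi> l. u (t - lag l), param \<xi>)"
        using feas False less.prems unfolding constraint_eq_0_iff[OF m] by simp
      ultimately show ?thesis
        using False by (simp add: simulate.simps[of _ _ _ t])
    qed
  qed
  then have "trajectory M u ?\<zeta> = (stack (param \<xi>) (outp \<xi>) :: real^('th + 'N \<times> 'p))"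
    unfolding trajectory_def param_stack by (rule stack_cong)
  then show ?thesis by simp
qed

section \<open>Costs along trajectories and stationarity\<close>

lemma wnorm_uminus [simp]: "wnorm W (- x) = wnorm W x"
  by (simp add: wnorm_def linear_neg[OF matrix_vector_mul_linear])

lemma wnorm_minus_commute: "wnorm W (a - b) = wnorm W (b - a)"
  using wnorm_uminus[of W "b - a"] by simp

text \<open>The two problems write their residuals with opposite signs, which the evenness of
  \<open>wnorm\<close> absorbs.\<close>

lemma objective_U_eq_cost_trajectory:
  "objective_U M u ymeas W \<rho> CARD('N) \<zeta> =
    cost_C ymeas W \<rho> (trajectory M u \<zeta> :: real^('th::finite + 'N::{finite,linorder} \<times> 'p::finite))"
  by (simp add: objective_U_def cost_C_def trajectory_def outp_stack wnorm_minus_commute[of W "ymeas _"])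

text \<open>The chain rule argument, isolated from the model. Differentiability of \<open>L\<close>
  at \<open>E \<zeta>\<close> is supplied by the \<open>GDERIV\<close> inside
  \<open>first_order_optimal\<close>.\<close>

lemma stationary_point_pullback:
  fixes L :: "real^'a::finite \<Rightarrow> real" and h :: "real^'a \<Rightarrow> real^'b::finite" and E :: "real^'c::finite \<Rightarrow> real^'a"
  assumes opt: "first_order_optimal L h (E \<zeta>)"
    and h: "h differentiable (at (E \<zeta>))" and E: "E differentiable (at \<zeta>)"
    and hE: "\<And>\<zeta>. h (E \<zeta>) = 0"
  shows "stationary_point (\<lambda>\<zeta>. L (E \<zeta>)) \<zeta>"
proof -
  let ?J = "jacobian h (at (E \<zeta>))"
  from opt obtain g \<mu> where g: "(L has_derivative (\<lambda>v. v \<bullet> g)) (at (E \<zeta>))"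
    and multiplier: "g + transpose ?J *v \<mu> = 0"
    unfolding first_order_optimal_def gderiv_def by blast
  from E obtain E' where E': "(E has_derivative E') (at \<zeta>)"
    unfolding differentiable_def by blast
  \<comment> \<open>\<open>jacobian\<close> is a total function; differentiability of
    \<open>h\<close> is what makes its value represent the derivative.\<close>
  from h have "(h has_derivative (*v) ?J) (at (E \<zeta>))"
    using jacobian_works by blast
  from has_derivative_compose[OF E' this] have "((\<lambda>_. 0) has_derivative (\<lambda>v. ?J *v E' v)) (at \<zeta>)"
    by (simp add: hE)
  \<comment> \<open>The constant map \<open>h \<circ> E\<close> also has derivative 0, and
    derivatives are unique.\<close>
  then have "(\<lambda>v. ?J *v E' v) = (\<lambda>_. 0)"
    using has_derivative_const by (rule has_derivative_unique)
  then have JE: "?J *v E' v = 0" for v by meson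
  have "E' v \<bullet> g = 0" for v
  proof -
    \<comment> \<open>The simplifier turns \<open>transpose ?J *v \<mu>\<close> into
      \<open>\<mu> v* ?J\<close>, the form in which \<open>?J\<close> can then be moved across the
      inner product.\<close>
    have "E' v \<bullet> g = - (E' v \<bullet> (\<mu> v* ?J))"
      using multiplier by (simp add: eq_neg_iff_add_eq_0 flip: inner_add_right)
    also have "\<dots> = - (\<mu> \<bullet> (?J *v E' v))"
      by (simp add: inner_commute[of "E' v"] dot_lmul_matrix)
    finally show ?thesis by (simp add: JE)
  qed
  with has_derivative_compose[OF E' g] show ?thesis
    by (simp add: stationary_point_def gderiv_def)
qed

theorem theorem1:
  fixes M :: "('n::{finite,linorder}, 'p::finite, 'q::finite, 'th::finite) model"
    and u :: "nat \<Rightarrow> real^'q"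
    and ymeas :: "nat \<Rightarrow> real^'p"
    and W :: "real^'p^'p"
    and \<rho> :: "real^'th \<Rightarrow> real"
    and \<theta> :: "real^'th"
    and y :: "nat \<Rightarrow> real^'p"
  assumes "CARD('n) < CARD('N::{finite,linorder})"
    and "CARD('m::{finite,linorder}) = CARD('N) - CARD('n)"
    and "\<forall>x. M differentiable (at x)"
    and "\<forall>x. \<rho> differentiable (at x)"
    and "pos_definite W"
    and "first_order_optimal
           (cost_C ymeas W \<rho> :: real^('th + 'N \<times> 'p) \<Rightarrow> real)
           (constraint M u :: real^('th + 'N \<times> 'p) \<Rightarrow> real^('m \<times> 'p))
           (stack \<theta> y)"
  shows "stationary_point (objective_U M u ymeas W \<rho> (CARD('N))) (stack \<theta> y :: real^('th + 'n \<times> 'p))"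
proof -
  let ?\<xi> = "stack \<theta> y :: real^('th + 'N \<times> 'p)" and ?\<zeta> = "stack \<theta> y :: real^('th + 'n \<times> 'p)"
  let ?E = "trajectory M u :: real^('th + 'n \<times> 'p) \<Rightarrow> real^('th + 'N \<times> 'p)"
  let ?h = "constraint M u :: real^('th + 'N \<times> 'p) \<Rightarrow> real^('m \<times> 'p)"
  \<comment> \<open>The first \<open>CARD('n)\<close> times are also positions in the longer stack,
    so reading blocks from \<open>?\<xi>\<close> there returns \<open>y\<close>.\<close>
  have "stack (param ?\<xi>) (outp ?\<xi>) = ?\<zeta>"
    unfolding param_stack using assms(1) by (intro stack_cong outp_stack) auto
  moreover have "?h ?\<xi> = 0"
    using assms(6) by (simp add: first_order_optimal_def)
  ultimately have "?E ?\<zeta> = ?\<xi>"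
    using trajectory_of_feasible[OF assms(2), of M u ?\<xi>] by simp
  then have "first_order_optimal (cost_C ymeas W \<rho>) ?h (?E ?\<zeta>)"
    using assms(6) by simp
  then have "stationary_point (\<lambda>\<zeta>. cost_C ymeas W \<rho> (?E \<zeta>)) ?\<zeta>"
  proof (rule stationary_point_pullback)
    show "?h differentiable (at (?E ?\<zeta>))"
      by (rule constraint_differentiable[OF assms(3)])
    show "?E differentiable (at ?\<zeta>)"
      unfolding trajectory_def[abs_def]
      by (intro stack_differentiable param_differentiable simulate_differentiable[OF assms(3)])
    show "?h (?E \<zeta>) = 0" for \<zeta>
      by (rule constraint_trajectory[OF assms(2)])
  qed
  then show ?thesis
    unfolding objective_U_eq_cost_trajectory[abs_def] .
qed

end
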